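(* Let $(X,\tau)$ be a $2$-path-flimsy topological space. Then, $X$ is compact, and there exists a unique topology $\tau_{\mathrm H}$ on $X$ finer than $\tau$ such that $(X,\tau_{\mathrm H})$ is a Hausdorff $2$-path-flimsy space. Namely, $\tau_{\mathrm H}$ is the topology generated by the path-connected components (with respect to $\tau$) of the subsets $X\setminus\{x,y\}$ as $(x,y)$ ranges over all pairs of distinct points of $X$. Furthermore, $(X,\tau)$ and $(X,\tau_{\mathrm H})$ have the same path-connected subsets and the same paths.
   Context: A path on a space $X$ is a continuous map $[0,1]\to X$; path-connectedness has its usual meaning, and the empty space is considered path-connected. A topological space $X$ is $2$-path-flimsy if $|X|>2$ and if, for any subset $S\subseteq X$, the subspace $X\setminus S$ is path-connected whenever $|S|<2$ and is not path-connected whenever $|S|=2$. "Compact" means that every open cover has a finite subcover (no Hausdorff assumption). "Finer" is meant in the non-strict sense ($\tau\subseteq\tau_{\mathrm H}$). The topology generated by a family of subsets is the coarsest topology containing that family. *)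

theory Defs
  imports "HOL-Analysis.Analysis"
begin

(* Since card is 0 on infinite sets, "more than two points" needs the infinite case
   separately, and "at most one point" needs an explicit finiteness condition. *)
definition two_path_flimsy :: "'a topology \<Rightarrow> bool" where
  "two_path_flimsy X \<longleftrightarrow>
     (infinite (topspace X) \<or> card (topspace X) > 2) \<and>
     (\<forall>S \<subseteq> topspace X.
        (finite S \<and> card S < 2 \<longrightarrow> path_connected_space (subtopology X (topspace X - S))) \<and>
        (card S = 2 \<longrightarrow> \<not> path_connected_space (subtopology X (topspace X - S))))"

definition finer_topology :: "'a topology \<Rightarrow> 'a topology \<Rightarrow> bool" where
  "finer_topology T X \<longleftrightarrow>
     topspace T = topspace X \<and> (\<forall>U. openin X U \<longrightarrow> openin T U)"

definition two_point_complement_components :: "'a topology \<Rightarrow> 'a set set" where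
  "two_point_complement_components X =
     (\<Union>x \<in> topspace X. \<Union>y \<in> topspace X - {x}.
        path_components_of (subtopology X (topspace X - {x, y})))"

(* The space underlying topology_generated_by F is the union of F; inserting topspace X
   yields the coarsest topology on the point set of X that contains the family. *)
definition tau_H :: "'a topology \<Rightarrow> 'a topology" where
  "tau_H X = topology_generated_by
     (insert (topspace X) (two_point_complement_components X))"

end

theory Submission
  imports Defs
begin

text \<open>
  A 2-path-flimsy space behaves like a circle, and the whole argument takes place in the
  complements of pairs of points. No separation axiom is available at first, so a path from
  \<open>a\<close> to a point of a finite set \<open>B\<close> need not have a first time in \<open>B\<close>. The lemma
  \<open>joined_to_hit_point\<close> is the substitute: \<open>a\<close> can be joined to some point of \<open>B\<close> by a path that
  stays in the path component of \<open>a\<close> off \<open>B\<close> together with that one point. If the infimum of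
  the times in \<open>B\<close> is not attained, then a point of \<open>B\<close> lies in every neighbourhood of the
  limiting point, and a path may jump from the latter to the former.

  Let \<open>u \<noteq> v\<close>. Each path component \<open>W\<close> of the complement of \<open>{u,v}\<close> can be joined to
  \<open>u\<close> and to \<open>v\<close>, because the complement of one point is path-connected. The lemma
  \<open>separation\<close> carries the rest: if \<open>w\<close> and \<open>z\<close> lie in different components, then
  \<open>u\<close> and \<open>v\<close> are not joined in the complement of \<open>{w,z}\<close>. For every other point is joined there
  to \<open>u\<close> or to \<open>v\<close>, so otherwise the complement of \<open>{w,z}\<close> would be path-connected. It follows that
  there are exactly two components, that the space is T1 (a jump from \<open>u\<close> to \<open>v\<close> would
  avoid \<open>w\<close> and \<open>z\<close>), and that a path from \<open>u\<close> to \<open>v\<close> inside \<open>{u,v} \<union> W\<close> passes through all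
  points of \<open>W\<close>. Hence the space is a union of two images of paths and so is compact.

  By \<open>separation\<close> again, the components of complements of pairs separate points, so
  \<open>tau_H\<close> is Hausdorff. It is finer than the given topology by \<open>small_pair_component\<close>: a point
  \<open>w\<close> of \<open>W\<close> cuts off an initial segment at \<open>u\<close>, namely the points of \<open>W\<close> joined to \<open>u\<close>
  without \<open>w\<close>. As these segments are ordered (\<open>segments_antisym\<close>), the segment of
  a point early on a path from \<open>u\<close> to \<open>v\<close> is covered by the beginning of that path and so is contained
  in a prescribed neighbourhood of \<open>u\<close>. Two such segments, one from each component, make up the
  component of \<open>u\<close> in the complement of a pair. A path stays continuous for \<open>tau_H\<close>
  because the complement of a pair is open, and a short piece of a path inside it stays
  inside one path component. So paths, path-connected subsets and
  2-path-flimsiness are the same for both topologies.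

  For uniqueness, let \<open>T\<close> be a finer Hausdorff 2-path-flimsy topology. Complements of pairs have
  two components for either topology, so the components agree and \<open>tau_H T = tau_H X\<close>. The
  identity from \<open>tau_H T\<close> to \<open>T\<close> is a continuous bijection from a compact space onto a
  Hausdorff space, whence \<open>tau_H T = T\<close>.
\<close>

text \<open>Two points are joined in \<open>B\<close> if a path inside \<open>B\<close> connects them. The definition intersects
  \<open>B\<close> with the point set of the space, so \<open>B\<close> may be any set.\<close>

abbreviation joined :: "'a topology \<Rightarrow> 'a set \<Rightarrow> 'a \<Rightarrow> 'a \<Rightarrow> bool" where
  "joined X B \<equiv> path_component_of (subtopology X B)"

text \<open>The path component of a point in a subspace; it is empty if the point is not in
  the subspace.\<close>

abbreviation component :: "'a topology \<Rightarrow> 'a set \<Rightarrow> 'a \<Rightarrow> 'a set" where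
  "component X B a \<equiv> Collect (joined X B a)"

section \<open>Paths in subspaces\<close>

lemma joined_iff_path:
  "joined X B a b \<longleftrightarrow> (\<exists>g. pathin X g \<and> g ` {0..1} \<subseteq> B \<and> g 0 = a \<and> g 1 = b)"
  unfolding path_component_of_def pathin_subtopology by (auto simp: image_subset_iff)

lemma joined_in: "joined X B a b \<Longrightarrow> a \<in> topspace X \<and> a \<in> B \<and> b \<in> topspace X \<and> b \<in> B"
  using path_component_in_topspace by fastforce

lemma component_subset: "component X B a \<subseteq> topspace X \<inter> B"
  using joined_in by (metis IntI mem_Collect_eq subsetI)

lemma joined_refl: "a \<in> topspace X \<Longrightarrow> a \<in> B \<Longrightarrow> joined X B a a"
  by (simp add: path_component_of_refl)

lemma joined_within_component:
  assumes "joined X B a b"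
  shows "joined X (component X B a) a b"
proof -
  have "path_connectedin X (component X B a)"
    by (metis path_connectedin_path_component_of path_connectedin_subtopology)
  with assms show ?thesis
    by (metis joined_in mem_Collect_eq path_component_of path_component_of_refl
        path_connectedin_absolute topspace_subtopology IntI)
qed

lemma joined_along_path:
  assumes g: "pathin X g" and "s \<in> {0..1}" "t \<in> {0..1}" "s \<le> t" and B: "g ` {s..t} \<subseteq> B"
  shows "joined X B (g s) (g t)"
proof -
  have "path_connectedin X (g ` {s..t})"
  proof (rule path_connectedin_continuous_map_image)
    show "continuous_map (top_of_set {0..1}) X g"
      using g by (simp add: pathin_def)
    show "path_connectedin (top_of_set {0..1}) {s..t}"
      using assms by (auto simp: path_connectedin_subtopology is_interval_1 is_interval_path_connected)
  qed
  then have "path_connectedin (subtopology X B) (g ` {s..t})"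
    using B by (simp add: path_connectedin_subtopology)
  then show ?thesis
    unfolding path_component_of using \<open>s \<le> t\<close> by force
qed

lemma pathin_locally_in_open:
  assumes "pathin X g" "openin X N" "t \<in> {0..1}" "g t \<in> N"
  obtains e where "e > 0" "\<And>r. r \<in> {0..1} \<Longrightarrow> dist r t < e \<Longrightarrow> g r \<in> N"
proof -
  have "openin (top_of_set {0..1}) {r \<in> {0..1}. g r \<in> N}"
    using assms(1,2) by (auto simp: pathin_def continuous_map_def)
  with that assms(3,4) show ?thesis
    unfolding openin_euclidean_subtopology_iff by auto
qed

text \<open>A point \<open>p\<close> all of whose neighbourhoods contain \<open>u\<close> is joined to \<open>u\<close> by a jump: the path that
  is \<open>p\<close> at time \<open>0\<close> and \<open>u\<close> afterwards is continuous.\<close>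

lemma joined_if_specializes:
  assumes "p \<in> topspace X" "u \<in> topspace X"
    and spec: "\<And>U. openin X U \<Longrightarrow> p \<in> U \<Longrightarrow> u \<in> U"
  shows "joined X {p, u} p u"
proof -
  define g where "g = (\<lambda>t::real. if t = 0 then p else u)"
  have "openin (top_of_set {0..1}) {t \<in> {0..1}. g t \<in> U}" if "openin X U" for U
  proof -
    consider "p \<in> U" "u \<in> U" | "p \<notin> U" "u \<in> U" | "p \<notin> U" "u \<notin> U"
      using spec \<open>openin X U\<close> by blast
    then show ?thesis
    proof cases
      case 1
      then have "{t \<in> {0..1}. g t \<in> U} = {0..1}"
        by (auto simp: g_def)
      then show ?thesis
        by (metis openin_subtopology_self)
    next
      case 3
      then have "{t \<in> {0..1}. g t \<in> U} = {}"
        by (simp add: g_def)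
      then show ?thesis
        by (metis openin_empty)
    next
      case 2
      then have "{t \<in> {0..1}. g t \<in> U} = {0..1} \<inter> {0<..}"
        by (auto simp: g_def)
      then show ?thesis
        using openin_open_Int[of "{0<..}" "{0..1::real}"] by simp
    qed
  qed
  moreover have "g \<in> {0..1} \<rightarrow> topspace X"
    using assms(1,2) by (simp add: g_def)
  ultimately have "pathin X g"
    by (simp add: pathin_def continuous_map_def)
  then show ?thesis
    unfolding joined_iff_path by (intro exI[of _ g]) (simp add: g_def image_subset_iff)
qed

text \<open>A replacement for stopping a path at its first time in a finite set, valid without any
  separation axiom. If the infimum of the times in \<open>B\<close> is not attained, the last step of the new path
  is a jump into \<open>B\<close>.\<close>

lemma joined_to_hit_point:
  assumes ab: "joined X A a b" and "finite B" "b \<in> B" "a \<notin> B"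
  shows "\<exists>u\<in>B \<inter> A. joined X (insert u (component X (A - B) a)) a u"
proof -
  obtain g where g: "pathin X g" "g ` {0..1} \<subseteq> A" "g 0 = a" "g 1 = b"
    using ab joined_iff_path by metis
  define S where "S = {t \<in> {0..1}. g t \<in> B}"
  define t0 where "t0 = Inf S"
  have S: "1 \<in> S" "bdd_below S"
    using g \<open>b \<in> B\<close> by (auto simp: S_def)
  have t0: "0 \<le> t0" "t0 \<le> 1"
    using S by (auto simp: t0_def S_def intro: cInf_lower cInf_greatest)
  have before: "g t \<notin> B" if "0 \<le> t" "t < t0" for t
    using that t0 S cInf_lower[of t S] by (force simp: t0_def S_def)
  have reach: "g t \<in> component X (A - B) a" if "0 \<le> t" "t \<le> t0" "g t \<notin> B" for t
  proof -
    have "g ` {0..t} \<subseteq> A - B"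
    proof (intro image_subsetI)
      fix r assume "r \<in> {0..t}"
      then show "g r \<in> A - B"
        using before[of r] g(2) that t0 by (cases "r = t") (auto simp: image_subset_iff)
    qed
    then show ?thesis
      using joined_along_path[OF g(1), of 0 t] that t0 g(3) by auto
  qed
  show ?thesis
  proof (cases "g t0 \<in> B")
    case True
    have "g ` {0..t0} \<subseteq> insert (g t0) (component X (A - B) a)"
    proof (intro image_subsetI)
      fix r assume "r \<in> {0..t0}"
      then show "g r \<in> insert (g t0) (component X (A - B) a)"
        using before[of r] reach[of r] by (cases "r = t0") auto
    qed
    then have "joined X (insert (g t0) (component X (A - B) a)) a (g t0)"
      using joined_along_path[OF g(1), of 0 t0] t0 g(3) by auto
    then show ?thesis
      using True g(2) t0 by (intro bexI[of _ "g t0"]) auto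
  next
    case False
    \<comment> \<open>If every such \<open>u\<close> were missed by a neighbourhood of \<open>g t0\<close>, so would all of them
      be by one neighbourhood, since \<open>B\<close> is finite; but \<open>g\<close> enters \<open>B\<close> right after \<open>t0\<close>.\<close>
    have "\<exists>u\<in>B \<inter> A. u \<in> topspace X \<and> (\<forall>U. openin X U \<longrightarrow> g t0 \<in> U \<longrightarrow> u \<in> U)"
    proof (rule ccontr)
      assume "\<not> ?thesis"
      then obtain N where N: "\<And>u. u \<in> B \<inter> A \<inter> topspace X \<Longrightarrow> openin X (N u) \<and> g t0 \<in> N u \<and> u \<notin> N u"
        by (metis Int_iff[of _ "B \<inter> A" "topspace X"])
      define V where "V = topspace X \<inter> \<Inter>(N ` (B \<inter> A \<inter> topspace X))"
      have gV: "g t0 \<in> V"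
        using N g(1) t0 path_image_subset_topspace by (fastforce simp: V_def)
      have "openin X V"
        unfolding V_def using N \<open>finite B\<close>
        by (cases "B \<inter> A \<inter> topspace X = {}") (auto intro!: openin_Int openin_Inter)
      then obtain e where e: "e > 0" "\<And>t. t \<in> {0..1} \<Longrightarrow> dist t t0 < e \<Longrightarrow> g t \<in> V"
        using pathin_locally_in_open[OF g(1), of V t0] gV t0 by auto
      obtain s where s: "s \<in> S" "s < t0 + e"
        using S e(1) cInf_lessD[of S "t0 + e"] by (auto simp: t0_def)
      moreover have "t0 \<le> s"
        using s S by (simp add: t0_def cInf_lower)
      ultimately have "g s \<in> V" "g s \<in> B" "g s \<in> A" 
        using e g(2) by (auto simp: S_def dist_real_def)
      then show False
        using N by (auto simp: V_def)
    qed
    then obtain u where u: "u \<in> B" "u \<in> A" "u \<in> topspace X" "\<And>U. openin X U \<Longrightarrow> g t0 \<in> U \<Longrightarrow> u \<in> U"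
      by blast
    have c: "joined X (A - B) a (g t0)"
      using reach[of t0] False t0 by auto
    then have "joined X {g t0, u} (g t0) u"
      using joined_if_specializes u joined_in by metis
    then have "joined X (insert u (component X (A - B) a)) (g t0) u"
      by (rule path_component_of_mono) (use c in auto)
    moreover have "joined X (insert u (component X (A - B) a)) a (g t0)"
      using joined_within_component[OF c] by (rule path_component_of_mono) auto
    ultimately show ?thesis
      using u(1,2) by (meson IntI path_component_of_trans)
  qed
qed

section \<open>Subbasic open sets\<close>

lemma topspace_tau_H: "topspace (tau_H X) = topspace X"
proof -
  have "\<Union>(two_point_complement_components X) \<subseteq> topspace X"
    unfolding two_point_complement_components_def
    using path_components_of_subset by fastforce
  then show ?thesis
    unfolding tau_H_def by auto
qed

lemma openin_tau_H_component:
  assumes "p \<in> topspace X" "q \<in> topspace X" "p \<noteq> q" "a \<in> topspace X - {p,q}"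
  shows "openin (tau_H X) (component X (topspace X - {p,q}) a)"
proof -
  have "component X (topspace X - {p,q}) a \<in> path_components_of (subtopology X (topspace X - {p,q}))"
    using assms(4) by (simp add: path_components_of_def)
  then have "component X (topspace X - {p,q}) a \<in> two_point_complement_components X"
    unfolding two_point_complement_components_def using assms by blast
  then show ?thesis
    unfolding tau_H_def by (intro topology_generated_by_Basis) simp
qed

section \<open>Complements of pairs\<close>

context
  fixes X :: "'a topology"
  assumes flimsy: "two_path_flimsy X"
begin

lemma joined_minus_point:
  assumes "x \<in> topspace X - {z}" "y \<in> topspace X - {z}"
  shows "joined X (topspace X - {z}) x y"
proof -
  let ?S = "topspace X \<inter> {z}"
  have "card ?S \<le> card {z}" by (intro card_mono) auto
  then have "path_connected_space (subtopology X (topspace X - ?S))"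
    using flimsy unfolding two_path_flimsy_def by auto
  moreover have "topspace X - ?S = topspace X - {z}" by auto
  ultimately show ?thesis
    using assms by (simp add: path_connected_space_iff_path_component)
qed

lemma two_components:
  assumes "u \<in> topspace X" "v \<in> topspace X" "u \<noteq> v"
  obtains a b where "a \<in> topspace X - {u,v}" "b \<in> topspace X - {u,v}"
    "\<not> joined X (topspace X - {u,v}) a b"
proof -
  have "\<not> path_connected_space (subtopology X (topspace X - {u,v}))"
    using flimsy assms unfolding two_path_flimsy_def by simp
  then show ?thesis
    using that by (auto simp: path_connected_space_iff_path_component)
qed

text \<open>Each component of the complement of a pair reaches both removed points.\<close>

lemma joined_to_removed_point:
  assumes "u \<in> topspace X" "a \<in> topspace X - {u,v}" "u \<noteq> v"
  shows "joined X (insert u (component X (topspace X - {u,v}) a)) a u"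
proof -
  have "joined X (topspace X - {v}) a u"
    using assms joined_minus_point by auto
  from joined_to_hit_point[OF this, of "{u}"] assms
  show ?thesis by (auto simp: insert_commute Diff_insert2[symmetric])
qed

lemma joined_removed_points:
  assumes "u \<in> topspace X" "v \<in> topspace X" "u \<noteq> v" "a \<in> topspace X - {u,v}"
  shows "joined X ({u,v} \<union> component X (topspace X - {u,v}) a) u v"
proof -
  let ?A = "{u,v} \<union> component X (topspace X - {u,v}) a"
  have "joined X ?A a u"
    by (rule path_component_of_mono[OF joined_to_removed_point[of u a v]]) (use assms in auto)
  moreover have "joined X ?A a v"
    by (rule path_component_of_mono[OF joined_to_removed_point[of v a u]])
      (use assms in \<open>auto simp: insert_commute\<close>)
  ultimately show ?thesis
    by (meson path_component_of_sym path_component_of_trans)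
qed

text \<open>After the removal of a further point \<open>w\<close>, a point of a component still reaches one of \<open>u\<close> and
  \<open>v\<close> without leaving its component.\<close>

lemma joined_to_removed_point_avoiding:
  assumes "u \<in> topspace X" "s \<in> topspace X - {u,v,w}" "u \<noteq> w"
  shows "\<exists>p\<in>{u,v}. joined X ({u,v} \<union> component X (topspace X - {u,v}) s - {w}) s p"
proof -
  have "joined X (topspace X - {w}) s u"
    using assms joined_minus_point by auto
  from joined_to_hit_point[OF this, of "{u,v}"] assms
  obtain p where p: "p \<in> {u,v}" "p \<noteq> w"
    "joined X (insert p (component X (topspace X - {w} - {u,v}) s)) s p" by auto
  have "insert p (component X (topspace X - {w} - {u,v}) s)
      \<subseteq> {u,v} \<union> component X (topspace X - {u,v}) s - {w}"
  proof (intro subsetI)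
    fix q assume "q \<in> insert p (component X (topspace X - {w} - {u,v}) s)"
    then consider "q = p" | "joined X (topspace X - {w} - {u,v}) s q" by auto
    then show "q \<in> {u,v} \<union> component X (topspace X - {u,v}) s - {w}"
    proof cases
      case 2
      then have "joined X (topspace X - {u,v}) s q"
        by (rule path_component_of_mono) auto
      with joined_in[OF 2] show ?thesis by auto
    qed (use p in auto)
  qed
  with p show ?thesis
    using path_component_of_mono[OF p(3)] by blast
qed

lemma joined_to_removed_point_avoiding_two:
  assumes uv: "u \<in> topspace X" "v \<in> topspace X" "u \<noteq> v"
    and wz: "w \<in> topspace X - {u,v}" "z \<in> topspace X - {u,v}"
    and nj: "\<not> joined X (topspace X - {u,v}) w z"
    and s: "s \<in> topspace X - {w,z}"
  shows "\<exists>p\<in>{u,v}. joined X (topspace X - {w,z}) s p"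
proof (cases "s \<in> {u,v}")
  case True
  then have "joined X (topspace X - {w,z}) s s"
    using s by (intro joined_refl) auto
  then show ?thesis using True by blast
next
  case False
  let ?W = "component X (topspace X - {u,v}) s"
  have sub: "?W \<subseteq> topspace X"
    using component_subset[of X "topspace X - {u,v}" s] by simp
  have "w \<notin> ?W \<or> z \<notin> ?W"
    using nj path_component_of_trans[OF path_component_of_sym, of _ s w z] by auto
  then obtain x where x: "x \<in> {w,z}" "{u,v} \<union> ?W - {x} \<subseteq> topspace X - {w,z}"
  proof
    assume "w \<notin> ?W"
    then have "{u,v} \<union> ?W - {z} \<subseteq> topspace X - {w,z}"
      using sub uv wz by blast
    then show ?thesis using that by blast
  next
    assume "z \<notin> ?W"
    then have "{u,v} \<union> ?W - {w} \<subseteq> topspace X - {w,z}"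
      using sub uv wz by blast
    then show ?thesis using that by blast
  qed
  have "\<exists>p\<in>{u,v}. joined X ({u,v} \<union> ?W - {x}) s p"
    using joined_to_removed_point_avoiding[of u s v x] uv s False x(1) wz by auto
  then show ?thesis
    using path_component_of_mono[OF _ x(2)] by blast
qed

text \<open>The pairs \<open>{u,v}\<close> and \<open>{w,z}\<close> separate each other, as on a circle. A path from \<open>u\<close> to \<open>v\<close> off
  \<open>{w,z}\<close> would make the complement of \<open>{w,z}\<close> path-connected, since everything else there reaches
  \<open>u\<close> or \<open>v\<close>.\<close>

lemma separation:
  assumes uv: "u \<in> topspace X" "v \<in> topspace X" "u \<noteq> v"
    and wz: "w \<in> topspace X - {u,v}" "z \<in> topspace X - {u,v}"
    and nj: "\<not> joined X (topspace X - {u,v}) w z"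
  shows "\<not> joined X (topspace X - {w,z}) u v"
proof
  assume J: "joined X (topspace X - {w,z}) u v"
  have "w \<noteq> z"
    using nj wz joined_refl by (metis DiffD1)
  then obtain a b where ab: "a \<in> topspace X - {w,z}" "b \<in> topspace X - {w,z}"
    "\<not> joined X (topspace X - {w,z}) a b"
    using two_components[of w z] wz by auto
  have "joined X (topspace X - {w,z}) s u" if "s \<in> topspace X - {w,z}" for s
    using joined_to_removed_point_avoiding_two[OF uv wz nj that] J
    by (metis empty_iff insert_iff path_component_of_sym path_component_of_trans)
  then show False
    using ab by (meson path_component_of_sym path_component_of_trans)
qed

text \<open>A third component would join \<open>u\<close> to \<open>v\<close> without meeting the first two.\<close>

lemma only_two_components:
  assumes uv: "u \<in> topspace X" "v \<in> topspace X" "u \<noteq> v"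
    and ab: "a \<in> topspace X - {u,v}" "b \<in> topspace X - {u,v}"
    and nj: "\<not> joined X (topspace X - {u,v}) a b"
    and s: "s \<in> topspace X - {u,v}"
  shows "joined X (topspace X - {u,v}) a s \<or> joined X (topspace X - {u,v}) b s"
proof (rule ccontr)
  assume *: "\<not> ?thesis"
  have "{u,v} \<union> component X (topspace X - {u,v}) s \<subseteq> topspace X - {a,b}"
    using * ab uv component_subset[of X "topspace X - {u,v}" s]
    by (auto dest: path_component_of_sym)
  then have "joined X (topspace X - {a,b}) u v"
    using joined_removed_points[OF uv s] path_component_of_mono by metis
  then show False
    using separation[OF uv ab nj] by simp
qed

lemma removed_points_not_joined_avoiding:
  assumes uv: "u \<in> topspace X" "v \<in> topspace X" "u \<noteq> v"
    and ab: "a \<in> topspace X - {u,v}" 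
    and w: "w \<in> component X (topspace X - {u,v}) a"
  shows "\<not> joined X ({u,v} \<union> component X (topspace X - {u,v}) a - {w}) u v"
proof -
  obtain b c where bc: "b \<in> topspace X - {u,v}" "c \<in> topspace X - {u,v}"
    "\<not> joined X (topspace X - {u,v}) b c"
    using two_components[OF uv] by metis
  obtain z where z: "z \<in> topspace X - {u,v}" "\<not> joined X (topspace X - {u,v}) a z"
  proof (cases "joined X (topspace X - {u,v}) a b")
    case True
    then have "\<not> joined X (topspace X - {u,v}) a c"
      using True bc(3) path_component_of_trans[OF path_component_of_sym, of _ a b c] by auto
    then show ?thesis using that bc(2) by blast
  qed (use that bc(1) in blast)
  have nz: "\<not> joined X (topspace X - {u,v}) w z"
    using z(2) w path_component_of_trans[of _ a w z] by auto
  have "{u,v} \<union> component X (topspace X - {u,v}) a - {w} \<subseteq> topspace X - {w,z}"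
    using uv z component_subset[of X "topspace X - {u,v}" a] by auto
  then show ?thesis
    using separation[OF uv _ z(1) nz] component_subset w path_component_of_mono
    by (metis (no_types, lifting) IntD2 subsetD)
qed

lemma t1: "t1_space X"
  unfolding t1_space_def
proof (intro ballI impI)
  fix x y assume xy: "x \<in> topspace X" "y \<in> topspace X" "x \<noteq> y"
  show "\<exists>U. openin X U \<and> x \<in> U \<and> y \<notin> U"
  proof (rule ccontr)
    assume "\<not> ?thesis"
    then have "y \<in> U" if "openin X U" "x \<in> U" for U
      using that by auto
    then have J: "joined X {x,y} x y"
      by (rule joined_if_specializes[OF xy(1,2)])
    obtain a b where ab: "a \<in> topspace X - {x,y}" "b \<in> topspace X - {x,y}"
      "\<not> joined X (topspace X - {x,y}) a b"
      by (rule two_components[OF xy])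
    have "joined X (topspace X - {a,b}) x y"
      by (rule path_component_of_mono[OF J]) (use ab xy in auto)
    then show False
      using separation[OF xy ab] by simp
  qed
qed

text \<open>A path from \<open>u\<close> to \<open>v\<close> through the component cannot omit any of its points.\<close>

lemma component_in_path_image:
  assumes uv: "u \<in> topspace X" "v \<in> topspace X" "u \<noteq> v" and a: "a \<in> topspace X - {u,v}" 
  obtains g where "pathin X g" "{u,v} \<union> component X (topspace X - {u,v}) a \<subseteq> g ` {0..1}"
proof -
  let ?A = "{u,v} \<union> component X (topspace X - {u,v}) a"
  obtain g where g: "pathin X g" "g ` {0..1} \<subseteq> ?A" "g 0 = u" "g 1 = v"
    using joined_removed_points[OF uv a] unfolding joined_iff_path by blast
  have "w \<in> g ` {0..1}" if w: "w \<in> component X (topspace X - {u,v}) a" for w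
  proof (rule ccontr)
    assume "w \<notin> g ` {0..1}"
    then have "joined X (?A - {w}) u v"
      using g unfolding joined_iff_path by (intro exI[of _ g]) auto
    with removed_points_not_joined_avoiding[OF uv a w] show False by simp
  qed
  moreover have "u \<in> g ` {0..1}" "v \<in> g ` {0..1}"
    using g by force+
  ultimately show ?thesis
    using that g(1) by blast
qed

lemma another_point: obtains y where "y \<in> topspace X" "y \<noteq> x"
proof -
  have "\<not> topspace X \<subseteq> {x}"
  proof
    assume sub: "topspace X \<subseteq> {x}"
    then have "card (topspace X) \<le> card {x}"
      by (intro card_mono) auto
    moreover have "finite (topspace X)"
      using sub by (rule finite_subset) simp
    ultimately show False
      using flimsy by (simp add: two_path_flimsy_def)
  qed
  then show ?thesis using that by blast
qed

lemma compact: "compact_space X"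
proof -
  obtain u where "u \<in> topspace X"
    using another_point by blast
  moreover obtain v where "v \<in> topspace X" "v \<noteq> u"
    using another_point by blast
  ultimately have uv: "u \<in> topspace X" "v \<in> topspace X" "u \<noteq> v"
    by auto
  then obtain a b where ab: "a \<in> topspace X - {u,v}" "b \<in> topspace X - {u,v}"
      "\<not> joined X (topspace X - {u,v}) a b"
    using two_components by metis
  obtain g where g: "pathin X g" "{u,v} \<union> component X (topspace X - {u,v}) a \<subseteq> g ` {0..1}"
    using component_in_path_image[OF uv ab(1)] by metis
  obtain h where h: "pathin X h" "{u,v} \<union> component X (topspace X - {u,v}) b \<subseteq> h ` {0..1}"
    using component_in_path_image[OF uv ab(2)] by metis
  have "topspace X \<subseteq> g ` {0..1} \<union> h ` {0..1}"
  proof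
    fix s assume s: "s \<in> topspace X"
    show "s \<in> g ` {0..1} \<union> h ` {0..1}"
    proof (cases "s \<in> {u,v}")
      case False
      then show ?thesis
        using only_two_components[OF uv ab, of s] s g(2) h(2) by blast
    qed (use g(2) in blast)
  qed
  moreover have "g ` {0..1} \<union> h ` {0..1} \<subseteq> topspace X"
    using g(1) h(1) path_image_subset_topspace by blast
  ultimately have "topspace X = g ` {0..1} \<union> h ` {0..1}" by blast
  then show ?thesis
    unfolding compact_space_def
    using compactin_Un compactin_path_image g(1) h(1) by metis
qed

section \<open>Initial segments of a component\<close>

text \<open>For \<open>s\<close> and \<open>w\<close> in the component \<open>W\<close>, say that \<open>s\<close> precedes \<open>w\<close> if \<open>s\<close> is joined to \<open>u\<close> in
  \<open>{u,v} \<union> W\<close> without \<open>w\<close>. This relation is antisymmetric: coming from \<open>v\<close>, one of the two points is reached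
  without the other one, and if it also precedes the other one, then \<open>u\<close> and \<open>v\<close> are
  joined without that other one.\<close>

lemma segments_antisym:
  assumes uv: "u \<in> topspace X" "v \<in> topspace X" "u \<noteq> v" and a: "a \<in> topspace X - {u,v}"
    and W: "W = component X (topspace X - {u,v}) a" and sw: "s \<in> W" "w \<in> W" "s \<noteq> w"
    and su: "joined X ({u,v} \<union> W - {w}) s u"
  shows "\<not> joined X ({u,v} \<union> W - {s}) w u"
proof
  let ?A = "{u,v} \<union> W"
  assume wu: "joined X (?A - {s}) w u"
  have "joined X ?A s u"
    by (rule path_component_of_mono[OF su]) auto
  moreover have "joined X ?A u v"
    unfolding W by (rule joined_removed_points[OF uv a])
  ultimately have vs: "joined X ?A v s"
    by (metis path_component_of_sym path_component_of_trans)
  have "v \<notin> {w,s}"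
    using sw component_subset[of X "topspace X - {u,v}" a] unfolding W by auto
  then obtain p where p: "p \<in> {w,s}" "joined X (insert p (component X (?A - {w,s}) v)) v p"
    using joined_to_hit_point[OF vs, of "{w,s}"] by auto
  \<comment> \<open>The point of the pair other than \<open>p\<close>: it is avoided on the way from \<open>v\<close> via \<open>p\<close> to \<open>u\<close>.\<close>
  define q where "q = (if p = w then s else w)"
  have "insert p (component X (?A - {w,s}) v) \<subseteq> ?A - {q}"
    using p(1) sw component_subset[of X "?A - {w,s}" v] unfolding q_def by auto
  then have "joined X (?A - {q}) v p"
    by (rule path_component_of_mono[OF p(2)])
  moreover have "joined X (?A - {q}) p u"
    using su wu p(1) unfolding q_def by auto
  ultimately have "joined X (?A - {q}) u v"
    by (metis path_component_of_sym path_component_of_trans)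
  moreover have "q \<in> W"
    using sw unfolding q_def by simp
  ultimately show False
    using removed_points_not_joined_avoiding[OF uv a, of q] unfolding W by simp
qed

text \<open>Some point \<open>w\<close> of \<open>W\<close> cuts off an initial segment at \<open>x\<close> that lies in the prescribed
  neighbourhood \<open>U\<close>. Take \<open>w\<close> on a path from \<open>x\<close> to \<open>y\<close>, before the path leaves \<open>U\<close>; a point
  of the segment that is missed by this part of the path would violate antisymmetry.\<close>

lemma small_segment:
  assumes xy: "x \<in> topspace X" "y \<in> topspace X" "x \<noteq> y" and a: "a \<in> topspace X - {x,y}"
    and W: "W = component X (topspace X - {x,y}) a"
    and U: "openin X U" "x \<in> U"
  obtains w where "w \<in> W" "\<And>s. s \<in> W \<Longrightarrow> joined X ({x,y} \<union> W - {w}) s x \<Longrightarrow> s \<in> U"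
proof -
  let ?A = "{x,y} \<union> W"
  obtain g where g: "pathin X g" "g ` {0..1} \<subseteq> ?A" "g 0 = x" "g 1 = y"
    using joined_removed_points[OF xy a] unfolding W joined_iff_path by blast
  \<comment> \<open>Leaving out \<open>y\<close> ensures that the path leaves the neighbourhood and that \<open>w \<noteq> y\<close>.\<close>
  define V where "V = U - {y}"
  have V: "openin X V" "x \<in> V" "y \<notin> V"
    using U t1 xy unfolding V_def t1_space_openin_delete_alt by auto
  define S where "S = {t \<in> {0..1}. g t \<notin> V}"
  define t0 where "t0 = Inf S"
  have S: "1 \<in> S" "bdd_below S"
    using g V by (auto simp: S_def)
  have t0: "0 \<le> t0" "t0 \<le> 1"
    using S by (auto simp: t0_def S_def intro: cInf_lower cInf_greatest)
  have before: "g t \<in> V" if "0 \<le> t" "t < t0" for t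
    using that t0 S cInf_lower[of t S] by (force simp: t0_def S_def)
  have exit: "g t0 \<notin> V"
  proof
    assume "g t0 \<in> V"
    then obtain e where e: "e > 0" "\<And>r. r \<in> {0..1} \<Longrightarrow> dist r t0 < e \<Longrightarrow> g r \<in> V"
      using pathin_locally_in_open[OF g(1) V(1), of t0] t0 by auto
    obtain r where r: "r \<in> S" "r < t0 + e"
      using S e(1) cInf_lessD[of S "t0 + e"] by (auto simp: t0_def)
    moreover have "t0 \<le> r"
      using r S by (simp add: t0_def cInf_lower)
    ultimately show False
      using e(2)[of r] by (auto simp: S_def dist_real_def)
  qed
  have "t0 \<noteq> 0"
    using exit V g(3) by auto
  have gt0: "g t0 \<in> topspace X - {x}" 
    using exit V g(1) t0 path_image_subset_topspace by fastforce
  have "openin X (topspace X - {x})"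
    using t1 openin_topspace unfolding t1_space_openin_delete_alt by blast
  then obtain e where e: "e > 0" "\<And>r. r \<in> {0..1} \<Longrightarrow> dist r t0 < e \<Longrightarrow> g r \<in> topspace X - {x}"
    using pathin_locally_in_open[OF g(1) _ _ gt0] t0 by auto
  \<comment> \<open>The path may rest at \<open>x\<close> for a while. Just before the exit time it is away from \<open>x\<close>, since
    the exit point differs from \<open>x\<close>.\<close>
  define t where "t = max (t0 / 2) (t0 - e / 2)"
  have t: "0 \<le> t" "t < t0" "dist t t0 < e"
    using t0 \<open>t0 \<noteq> 0\<close> e(1) by (auto simp: t_def dist_real_def max_def)
  define w where "w = g t"
  have wV: "w \<in> V"
    using before t unfolding w_def by simp
  have "w \<in> ?A"
    using g(2) t t0 unfolding w_def by (simp add: image_subset_iff)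
  then have w: "w \<in> W"
    using wV V(3) e(2)[of t] t t0 unfolding w_def by auto
  have "s \<in> U" if s: "s \<in> W" "joined X (?A - {w}) s x" for s
  proof (rule ccontr)
    assume "s \<notin> U"
    have "g ` {0..t} \<subseteq> ?A - {s}"
    proof (intro image_subsetI)
      fix r assume "r \<in> {0..t}"
      then show "g r \<in> ?A - {s}"
        using g(2) before[of r] t t0 \<open>s \<notin> U\<close> unfolding V_def by (auto simp: image_subset_iff)
    qed
    then have "joined X (?A - {s}) x w"
      using joined_along_path[OF g(1), of 0 t] t t0 g(3) unfolding w_def by auto
    then have "joined X (?A - {s}) w x"
      by (rule path_component_of_sym)
    moreover have "s \<noteq> w"
      using \<open>s \<notin> U\<close> wV unfolding V_def by auto
    ultimately show False
      using segments_antisym[OF xy a W s(1) w _ s(2)] by simp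
  qed
  with that w show ?thesis by blast
qed

section \<open>The topology generated by the components\<close>

text \<open>Every neighbourhood contains the component of its point in the complement of some pair.
  Two initial segments at \<open>x\<close>, one in each component of the complement of \<open>{x,y}\<close>, are
  cut off by \<open>p\<close> and \<open>q\<close> and cover, together with \<open>x\<close>, the component of \<open>x\<close> off \<open>{p,q}\<close>.\<close>

lemma small_pair_component:
  assumes U: "openin X U" "x \<in> U"
  obtains p q where "p \<in> topspace X - {x}" "q \<in> topspace X - {x}" "p \<noteq> q"
    "component X (topspace X - {p,q}) x \<subseteq> U"
proof -
  have x: "x \<in> topspace X"
    using U openin_subset by blast
  obtain y where y: "y \<in> topspace X" "x \<noteq> y"
    using another_point by metis
  note xy = x y
  obtain a b where ab: "a \<in> topspace X - {x,y}" "b \<in> topspace X - {x,y}"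
    and nj: "\<not> joined X (topspace X - {x,y}) a b"
    by (rule two_components[OF xy])
  define C where "C = component X (topspace X - {x,y})"
  have C: "C c \<subseteq> topspace X - {x,y}" for c
    using component_subset[of X "topspace X - {x,y}" c] unfolding C_def by auto
  have disj: "C a \<inter> C b = {}"
    using nj path_component_of_trans[OF _ path_component_of_sym, of _ a _ b] unfolding C_def by auto
  obtain p where p: "p \<in> C a" "\<And>s. s \<in> C a \<Longrightarrow> joined X ({x,y} \<union> C a - {p}) s x \<Longrightarrow> s \<in> U"
    using small_segment[OF xy ab(1) _ U, of "C a"] unfolding C_def by metis
  obtain q where q: "q \<in> C b" "\<And>s. s \<in> C b \<Longrightarrow> joined X ({x,y} \<union> C b - {q}) s x \<Longrightarrow> s \<in> U"
    using small_segment[OF xy ab(2) _ U, of "C b"] unfolding C_def by metis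
  have pq: "p \<in> topspace X - {x,y}" "q \<in> topspace X - {x,y}" "p \<noteq> q"
    using p(1) q(1) C disj by auto
  have "\<not> joined X (topspace X - {x,y}) p q"
  proof
    assume "joined X (topspace X - {x,y}) p q"
    then have "q \<in> C a"
      using p(1) path_component_of_trans[of _ a p q] unfolding C_def by simp
    then show False using disj q(1) by auto
  qed
  then have sep: "\<not> joined X (topspace X - {p,q}) x y"
    by (rule separation[OF xy pq(1,2)])
  have step: "s \<in> U" if s: "joined X (topspace X - {p,q}) x s" "s \<in> C c" "s \<noteq> r"
    and c: "C c \<inter> {p,q} \<subseteq> {r}"
    and r: "r \<in> {p,q}"
    and seg: "\<And>s. s \<in> C c \<Longrightarrow> joined X ({x,y} \<union> C c - {r}) s x \<Longrightarrow> s \<in> U" for s c r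
  proof -
    have sub: "{x,y} \<union> C c - {r} \<subseteq> topspace X - {p,q}"
      using c C pq xy by blast
    have Cs: "component X (topspace X - {x,y}) s = C c"
    proof -
      have "joined X (topspace X - {x,y}) c s"
        using s(2) unfolding C_def by simp
      then show ?thesis
        unfolding C_def by (metis path_component_of_equiv)
    qed
    have "s \<in> topspace X - {x,y,r}"
      using C s(2,3) by auto
    moreover have "x \<noteq> r"
      using r pq by auto
    ultimately have "\<exists>z\<in>{x,y}. joined X ({x,y} \<union> C c - {r}) s z"
      using joined_to_removed_point_avoiding[of x s y r] xy Cs by simp
    moreover have "\<not> joined X ({x,y} \<union> C c - {r}) s y"
      using path_component_of_mono[OF _ sub] s(1) sep path_component_of_trans by metis
    ultimately show "s \<in> U"
      using seg s(2) by auto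
  qed
  have "component X (topspace X - {p,q}) x \<subseteq> U"
  proof
    fix s assume "s \<in> component X (topspace X - {p,q}) x"
    then have s: "joined X (topspace X - {p,q}) x s" by simp
    have s': "s \<in> topspace X - {p,q}" "s \<noteq> y"
      using joined_in[OF s] s sep by auto
    show "s \<in> U"
    proof (cases "s = x")
      case False
      then have "s \<in> C a \<or> s \<in> C b"
        using only_two_components[OF xy ab nj, of s] s' unfolding C_def by auto
      then show ?thesis
      proof
        assume "s \<in> C a"
        then show ?thesis
          by (rule step[OF s, of a p]) (use s' C[of a] disj p q in auto)
      next
        assume "s \<in> C b"
        then show ?thesis
          by (rule step[OF s, of b q]) (use s' C[of b] disj p q in auto)
      qed
    qed (use U in simp)
  qed
  then show ?thesis
    using that pq by blast
qed

lemma tau_H_finer: "finer_topology (tau_H X) X"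
  unfolding finer_topology_def
proof (intro conjI allI impI)
  show "topspace (tau_H X) = topspace X"
    by (rule topspace_tau_H)
  fix U assume U: "openin X U"
  show "openin (tau_H X) U"
  proof (subst openin_subopen, intro ballI)
    fix x assume x: "x \<in> U"
    obtain p q where pq: "p \<in> topspace X - {x}" "q \<in> topspace X - {x}" "p \<noteq> q"
      "component X (topspace X - {p,q}) x \<subseteq> U"
      by (rule small_pair_component[OF U x])
    have x': "x \<in> topspace X - {p,q}"
      using pq x U openin_subset by blast
    have "openin (tau_H X) (component X (topspace X - {p,q}) x)"
      using pq x' by (intro openin_tau_H_component) auto
    moreover have "x \<in> component X (topspace X - {p,q}) x"
      using x' joined_refl by fastforce
    ultimately show "\<exists>T. openin (tau_H X) T \<and> x \<in> T \<and> T \<subseteq> U"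
      using pq(4) by blast
  qed
qed

lemma tau_H_Hausdorff: "Hausdorff_space (tau_H X)"
  unfolding Hausdorff_space_def topspace_tau_H
proof (intro allI impI)
  fix x y assume "x \<in> topspace X \<and> y \<in> topspace X \<and> x \<noteq> y"
  then have xy: "x \<in> topspace X" "y \<in> topspace X" "x \<noteq> y" by auto
  obtain p q where pq: "p \<in> topspace X - {x,y}" "q \<in> topspace X - {x,y}"
    and nj: "\<not> joined X (topspace X - {x,y}) p q"
    by (rule two_components[OF xy])
  have "p \<noteq> q"
    using nj pq joined_refl by (metis DiffD1)
  let ?C = "component X (topspace X - {p,q})"
  have "openin (tau_H X) (?C x)" "openin (tau_H X) (?C y)"
    using pq xy \<open>p \<noteq> q\<close> by (auto intro!: openin_tau_H_component)
  moreover have "x \<in> ?C x" "y \<in> ?C y"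
    using xy pq by (auto intro!: joined_refl)
  moreover have "disjnt (?C x) (?C y)"
    using separation[OF xy pq nj] path_component_of_trans[OF _ path_component_of_sym, of _ x _ y]
    unfolding disjnt_def by auto
  ultimately show "\<exists>U V. openin (tau_H X) U \<and> openin (tau_H X) V \<and> x \<in> U \<and> y \<in> V \<and> disjnt U V"
    by blast
qed

lemma pathin_tau_H:
  assumes g: "pathin X g"
  shows "pathin (tau_H X) g"
  unfolding pathin_def tau_H_def
proof (rule continuous_on_generated_topo)
  have gX: "g ` {0..1} \<subseteq> topspace X"
    using path_image_subset_topspace[OF g] by auto
  then show "g ` topspace (top_of_set {0..1}) \<subseteq> \<Union> (insert (topspace X) (two_point_complement_components X))"
    by auto
  fix U assume "U \<in> insert (topspace X) (two_point_complement_components X)"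
  then consider "U = topspace X"
    | p q where "p \<in> topspace X" "q \<in> topspace X"
        "U \<in> path_components_of (subtopology X (topspace X - {p,q}))"
    unfolding two_point_complement_components_def by auto
  then show "openin (top_of_set {0..1}) (g -` U \<inter> topspace (top_of_set {0..1}))"
  proof cases
    case 1
    then have "g -` U \<inter> {0..1} = {0..1}"
      using gX by auto
    then show ?thesis by simp
  next
    case 2
    define Q where "Q = topspace X - {p,q}"
    obtain a where a: "U = component X Q a"
      using 2(3) unfolding path_components_of_def Q_def by auto
    \<comment> \<open>Complements of pairs are open by T1.\<close>
    have "openin X (topspace X - {p} - {q})"
      using t1 openin_topspace unfolding t1_space_openin_delete_alt by blast
    moreover have "topspace X - {p} - {q} = Q"
      unfolding Q_def by auto
    ultimately have op: "openin X Q"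
      by simp
    have "\<exists>e>0. \<forall>r\<in>{0..1}. dist r t < e \<longrightarrow> r \<in> g -` U \<inter> {0..1}" if t: "t \<in> g -` U \<inter> {0..1}" for t
    proof -
      have agt: "joined X Q a (g t)"
        using t a by simp
      have "g t \<in> Q"
        using joined_in[OF agt] by simp
      then obtain e where e: "e > 0" "\<And>r. r \<in> {0..1} \<Longrightarrow> dist r t < e \<Longrightarrow> g r \<in> Q"
        using pathin_locally_in_open[OF g op, of t] t by auto
      have "g r \<in> U" if r: "r \<in> {0..1}" "dist r t < e" for r
      proof -
        have im: "g ` {min r t..max r t} \<subseteq> Q"
        proof (intro image_subsetI)
          fix l assume "l \<in> {min r t..max r t}"
          then have "l \<in> {0..1}" "dist l t < e"
            using r t by (auto simp: dist_real_def)
          then show "g l \<in> Q" by (rule e(2))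
        qed
        have "joined X Q (g (min r t)) (g (max r t))"
          by (rule joined_along_path[OF g _ _ _ im]) (use r t in auto)
        then have "joined X Q (g t) (g r)"
          by (cases "r \<le> t") (auto simp: min_def max_def intro: path_component_of_sym)
        then show ?thesis
          using path_component_of_trans[OF agt] a by simp
      qed
      then show ?thesis using e(1) by auto
    qed
    then show ?thesis
      unfolding openin_euclidean_subtopology_iff by auto
  qed
qed

end

section \<open>Comparison of topologies\<close>

lemma finer_continuous_id: "finer_topology T X \<Longrightarrow> continuous_map T X id"
  using topology_finer_continuous_id[of X T] by (simp add: finer_topology_def)

lemma finer_pathin: "finer_topology T X \<Longrightarrow> pathin T g \<Longrightarrow> pathin X g"
  using pathin_compose[OF _ finer_continuous_id, of T g X] by simp

lemma two_path_flimsy_cong: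
  assumes "topspace T = topspace X" "\<And>S. path_connectedin T S \<longleftrightarrow> path_connectedin X S"
    and "two_path_flimsy X"
  shows "two_path_flimsy T"
proof -
  have "path_connected_space (subtopology T (topspace X - S)) \<longleftrightarrow>
      path_connected_space (subtopology X (topspace X - S))" for S
    using assms(1) assms(2)[of "topspace X - S"] by (simp add: path_connectedin_def)
  then show ?thesis
    using assms(1,3) by (simp add: two_path_flimsy_def)
qed

lemma pathin_tau_H_iff:
  "two_path_flimsy X \<Longrightarrow> pathin (tau_H X) g \<longleftrightarrow> pathin X g"
  using pathin_tau_H finer_pathin tau_H_finer by metis

lemma path_connectedin_tau_H_iff:
  "two_path_flimsy X \<Longrightarrow> path_connectedin (tau_H X) S \<longleftrightarrow> path_connectedin X S"
  by (simp add: path_connectedin pathin_tau_H_iff topspace_tau_H)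

lemma two_path_flimsy_tau_H:
  "two_path_flimsy X \<Longrightarrow> two_path_flimsy (tau_H X)"
  by (rule two_path_flimsy_cong) (simp_all add: path_connectedin_tau_H_iff topspace_tau_H)

text \<open>Components for the finer topology are contained in components for the coarser one. If an inclusion
  were strict, the only two components for \<open>T\<close> would both lie in the same component for \<open>X\<close>.\<close>

lemma finer_component_eq:
  assumes X: "two_path_flimsy X" and T: "two_path_flimsy T" and fin: "finer_topology T X"
    and uv: "u \<in> topspace X" "v \<in> topspace X" "u \<noteq> v" and a: "a \<in> topspace X - {u,v}"
  shows "component T (topspace X - {u,v}) a = component X (topspace X - {u,v}) a"
proof -
  let ?Y = "topspace X - {u,v}"
  have top: "topspace T = topspace X"
    using fin by (simp add: finer_topology_def)
  have TX: "joined X ?Y c d" if "joined T ?Y c d" for c d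
    using that finer_pathin[OF fin] unfolding joined_iff_path by blast
  have "joined T ?Y a s" if s: "joined X ?Y a s" for s
  proof (rule ccontr)
    assume ns: "\<not> joined T ?Y a s"
    \<comment> \<open>For \<open>T\<close>, every point is in the component of \<open>a\<close> or in that of \<open>s\<close>.\<close>
    have "joined X ?Y a z" if z: "z \<in> ?Y" for z
      using only_two_components[OF T, unfolded top, OF uv a _ ns z] joined_in[OF s] 
        TX[of a z] TX[of s z] path_component_of_trans[OF s, of z] by auto
    then have "joined X ?Y c d" if "c \<in> ?Y" "d \<in> ?Y" for c d
      using that path_component_of_trans[OF path_component_of_sym, of _ a c d] by blast
    then show False
      using two_components[OF X uv] by metis
  qed
  with TX show ?thesis by blast
qed

lemma finer_tau_H_eq:
  assumes X: "two_path_flimsy X" and T: "two_path_flimsy T" and fin: "finer_topology T X"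
  shows "tau_H T = tau_H X"
proof -
  have top: "topspace T = topspace X"
    using fin by (simp add: finer_topology_def)
  have "path_components_of (subtopology T (topspace X - {u,v}))
      = path_components_of (subtopology X (topspace X - {u,v}))"
    if "u \<in> topspace X" "v \<in> topspace X - {u}" for u v
    using finer_component_eq[OF assms, of u v] that top
    unfolding path_components_of_def by (intro image_cong) auto
  then have "two_point_complement_components T = two_point_complement_components X"
    unfolding two_point_complement_components_def top by simp
  then show ?thesis
    by (simp add: tau_H_def top)
qed

lemma Hausdorff_flimsy_eq_tau_H:
  assumes T: "two_path_flimsy T" and "Hausdorff_space T"
  shows "tau_H T = T"
proof -
  have "continuous_map (tau_H T) T id"
    by (rule finer_continuous_id[OF tau_H_finer[OF T]])
  moreover have "compact_space (tau_H T)"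
    by (rule compact[OF two_path_flimsy_tau_H[OF T]])
  ultimately have "homeomorphic_map (tau_H T) T id"
    using assms(2) topspace_tau_H[of T] by (intro continuous_imp_homeomorphic_map) auto
  then show ?thesis by simp
qed

theorem theorem1p6:
  fixes X :: "'a topology"
  assumes "two_path_flimsy X"
  shows "compact_space X \<and>
    (\<exists>!T. finer_topology T X \<and> Hausdorff_space T \<and> two_path_flimsy T) \<and>
    (finer_topology (tau_H X) X \<and> Hausdorff_space (tau_H X) \<and> two_path_flimsy (tau_H X)) \<and>
    (\<forall>S. path_connectedin X S \<longleftrightarrow> path_connectedin (tau_H X) S) \<and>
    (\<forall>g. pathin X g \<longleftrightarrow> pathin (tau_H X) g)"
proof -
  have "finer_topology (tau_H X) X \<and> Hausdorff_space (tau_H X) \<and> two_path_flimsy (tau_H X)"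
    using tau_H_finer tau_H_Hausdorff two_path_flimsy_tau_H assms by blast
  moreover have "T = tau_H X" if "finer_topology T X" "Hausdorff_space T" "two_path_flimsy T" for T
    using finer_tau_H_eq[OF assms that(3,1)] Hausdorff_flimsy_eq_tau_H[OF that(3,2)] by simp
  ultimately show ?thesis
    using compact[OF assms] path_connectedin_tau_H_iff[OF assms] pathin_tau_H_iff[OF assms]
    by blast
qed

end
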